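(* For a nonnegative integer $k$ let $Q_k=\frac{k(k+1)(2k+1)}{6}$. Let $C$ and $k$ be nonnegative integers such that at least one of the following holds: - $C=Q_k$; - $Q_k+k<C<Q_{k+1}$; - $Q_{k+1}<C\le Q_{k+1}+k+1$. Then the maximum number of distinct valid answers among all natural tests of cost $C$ is $k$.
   Context: A natural test is a finite multiset of positive integers (its answers; order is irrelevant); the empty test has cost $0$. The cost of a test is the sum of all its answers with multiplicity. A positive integer $a$ is a valid answer of a natural test if $a$ appears in the test exactly $a$ times. *)

theory Defs
  imports Complex_Main "HOL-Library.Multiset"
begin

definition natural_test :: "nat multiset \<Rightarrow> bool" where
  "natural_test T \<longleftrightarrow> (\<forall>a \<in># T. 0 < a)"

definition cost :: "nat multiset \<Rightarrow> nat" where
  "cost T = sum_mset T"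

(* Positivity is required explicitly: 0 occurs exactly 0 times in every natural test. *)
definition valid_answer :: "nat multiset \<Rightarrow> nat \<Rightarrow> bool" where
  "valid_answer T a \<longleftrightarrow> 0 < a \<and> count T a = a"

definition num_valid :: "nat multiset \<Rightarrow> nat" where
  "num_valid T = card {a. valid_answer T a}"

definition max_num_valid :: "nat \<Rightarrow> nat" where
  "max_num_valid C = Max {num_valid T | T. natural_test T \<and> cost T = C}"

(* The division is exact, see real_Q. *)
definition Q :: "nat \<Rightarrow> nat" where
  "Q k = k * (k + 1) * (2 * k + 1) div 6"

lemma six_times_Q: "6 * Q k = k * (k + 1) * (2 * k + 1)"
proof -
  have "6 * (\<Sum>i\<le>k. i * i) = k * (k + 1) * (2 * k + 1)"
    by (induction k) (auto simp: algebra_simps)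
  then have "6 dvd k * (k + 1) * (2 * k + 1)"
    by (metis dvd_triv_left)
  then show ?thesis
    unfolding Q_def by (rule dvd_mult_div_cancel)
qed

lemma real_Q: "real (Q k) = real k * (real k + 1) * (2 * real k + 1) / 6"
proof -
  have "real (6 * Q k) = real (k * (k + 1) * (2 * k + 1))"
    by (simp only: six_times_Q)
  then show ?thesis by (simp add: algebra_simps)
qed

(* The Max in max_num_valid ranges over a finite nonempty set. *)

lemma finite_valid_answers: "finite {a. valid_answer T a}"
  by (rule finite_subset[of _ "set_mset T"])
    (auto simp: valid_answer_def simp flip: count_greater_zero_iff)

lemma num_valid_le_cost: "num_valid T \<le> cost T"
proof -
  have "a \<le> cost T" if "valid_answer T a" for a
    using that sum_mset.remove[of a T]
    by (simp add: valid_answer_def cost_def flip: count_greater_zero_iff)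
  then have "{a. valid_answer T a} \<subseteq> {1..cost T}"
    by (auto simp: valid_answer_def)
  then have "card {a. valid_answer T a} \<le> card {1..cost T}"
    by (intro card_mono) auto
  then show ?thesis by (simp add: num_valid_def)
qed

lemma finite_num_valid: "finite {num_valid T | T. natural_test T \<and> cost T = C}"
  by (rule finite_subset[of _ "{..C}"]) (auto simp: num_valid_le_cost)

lemma num_valid_nonempty: "{num_valid T | T. natural_test T \<and> cost T = C} \<noteq> {}"
proof -
  have "natural_test (if C = 0 then {#} else {#C#}) \<and> cost (if C = 0 then {#} else {#C#}) = C"
    by (simp add: natural_test_def cost_def)
  then show ?thesis by blast
qed

end

theory Submission
  imports Defs
begin

text \<open>
  If \<open>S\<close> is the set of valid answers of a test, the test contains every \<open>a \<in> S\<close> exactly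
  \<open>a\<close> times, so it costs at least \<open>\<Sum>a\<in>S. a\<^sup>2\<close>.  For sets of \<open>m\<close> positive integers this sum is
  minimal for \<open>{1..m}\<close>, where it is \<open>Q m\<close> (\<open>Q_card_le_sum_squares\<close>).

  Hence \<open>k + 1\<close> valid answers cannot occur below cost \<open>Q (k + 1)\<close>.  Slightly above that cost they
  still cannot occur.  Any competitor of \<open>{1..k + 1}\<close> contains an element \<open>\<ge> k + 2\<close> and so raises
  the sum of squares by at least \<open>(k + 2)\<^sup>2 - (k + 1)\<^sup>2 = 2k + 3\<close>
  (\<open>sum_squares_gap\<close>).  If the valid answers are \<open>{1..k + 1}\<close>, all further answers lie outside
  this set, because another copy of a valid answer would invalidate it; so the surplus is \<open>0\<close> or
  at least \<open>k + 2\<close> (\<open>surplus_over_initial_segment\<close>).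

  Conversely, cost \<open>Q k\<close> is attained with the valid answers \<open>{1..k}\<close> alone, and any cost beyond
  \<open>Q k + k\<close> by adding the whole surplus as one further answer, which exceeds \<open>k\<close> and therefore
  disturbs none of them (\<open>attains_k_valid\<close>).  Outside the case \<open>C = Q k\<close> both cost ranges lie beyond \<open>Q k + k\<close>.
\<close>

definition self_counting :: "nat set \<Rightarrow> nat multiset" where
  "self_counting S = (\<Sum>a\<in>S. replicate_mset a a)"

lemma count_self_counting:
  assumes "finite S"
  shows "count (self_counting S) a = (if a \<in> S then a else 0)"
  using assms by (simp add: self_counting_def count_sum sum.delta)

lemma cost_self_counting:
  assumes "finite S"
  shows "cost (self_counting S) = (\<Sum>a\<in>S. a\<^sup>2)"
  using assms
  by (induction rule: finite_induct)
    (simp_all add: self_counting_def cost_def sum_mset_replicate_mset power2_eq_square)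

lemma cost_add: "cost (A + B) = cost A + cost B"
  by (simp add: cost_def)

lemma self_counting_valid_answers_subset: "self_counting {a. valid_answer T a} \<subseteq># T"
proof (rule mset_subset_eqI)
  fix a
  show "count (self_counting {a. valid_answer T a}) a \<le> count T a"
    unfolding count_self_counting[OF finite_valid_answers] by (simp add: valid_answer_def)
qed

lemma Q_Suc: "Q (Suc k) = Q k + (Suc k)\<^sup>2"
proof -
  have "6 * Q (Suc k) = 6 * (Q k + (Suc k)\<^sup>2)"
    unfolding distrib_left six_times_Q by (simp add: algebra_simps power2_eq_square)
  then show ?thesis by simp
qed

lemma Q_0 [simp]: "Q 0 = 0"
  by (simp add: Q_def)

lemma Q_mono: "m \<le> n \<Longrightarrow> Q m \<le> Q n"
  by (rule lift_Suc_mono_le[of Q]) (simp_all add: Q_Suc)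

lemma sum_squares_atLeastAtMost_eq_Q: "(\<Sum>a\<in>{1..k}. a\<^sup>2) = Q k"
  by (induction k) (simp_all add: Q_Suc)

lemma card_le_Max_of_positive:
  fixes S :: "nat set"
  assumes "finite S" "\<forall>a\<in>S. 0 < a"
  shows "card S \<le> Max S"
proof -
  have "S \<subseteq> {1..Max S}"
    using assms by (auto simp: Suc_le_eq)
  from card_mono[OF _ this] show ?thesis by simp
qed

text \<open>
  Induction adding elements in increasing order: the largest of \<open>m + 1\<close> positive integers is at
  least \<open>m + 1\<close>, so its square is at least the increment from \<open>Q m\<close> to \<open>Q (m + 1)\<close>.
\<close>

lemma Q_card_le_sum_squares:
  fixes S :: "nat set"
  assumes "finite S" "\<forall>a\<in>S. 0 < a"
  shows "Q (card S) \<le> (\<Sum>a\<in>S. a\<^sup>2)"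
  using assms
proof (induction rule: finite_linorder_max_induct)
  case empty
  then show ?case by simp
next
  case (insert M S)
  from insert.hyps have "M \<notin> S" by auto
  have "Max (insert M S) = M"
    using insert.hyps by (intro Max_eqI) auto
  then have "Suc (card S) \<le> M"
    using card_le_Max_of_positive[of "insert M S"] insert.hyps insert.prems \<open>M \<notin> S\<close> by simp
  then have "(Suc (card S))\<^sup>2 \<le> M\<^sup>2"
    by (rule power_mono) simp
  moreover have "Q (card S) \<le> (\<Sum>a\<in>S. a\<^sup>2)"
    using insert by simp
  ultimately have "Q (card S) + (Suc (card S))\<^sup>2 \<le> M\<^sup>2 + (\<Sum>a\<in>S. a\<^sup>2)"
    by linarith
  then show ?case
    using insert.hyps(1) \<open>M \<notin> S\<close>
    by (simp only: Q_Suc card_insert_disjoint sum.insert not_False_eq_True)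
qed

text \<open>
  A set of \<open>m\<close> positive integers other than \<open>{1..m}\<close> has a maximum of at least \<open>m + 1\<close>, and the
  other \<open>m - 1\<close> elements contribute at least \<open>Q (m - 1)\<close>.
\<close>

lemma sum_squares_gap:
  fixes S :: "nat set"
  assumes "finite S" "\<forall>a\<in>S. 0 < a" and card: "card S = Suc k" and "S \<noteq> {1..Suc k}"
  shows "Q (Suc k) + 2 * k + 3 \<le> (\<Sum>a\<in>S. a\<^sup>2)"
proof -
  have "\<not> S \<subseteq> {1..Suc k}"
    using assms card_subset_eq[of "{1..Suc k}" S] by auto
  then obtain M where M: "M \<in> S" "k + 2 \<le> M"
    using assms(2) by (fastforce simp: Suc_le_eq not_le)
  have "Q k \<le> (\<Sum>a\<in>S - {M}. a\<^sup>2)"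
    using Q_card_le_sum_squares[of "S - {M}"] assms(1,2) card M(1) by simp
  moreover have "(k + 2)\<^sup>2 \<le> M\<^sup>2"
    using M(2) by (rule power_mono) simp
  moreover have "(\<Sum>a\<in>S. a\<^sup>2) = M\<^sup>2 + (\<Sum>a\<in>S - {M}. a\<^sup>2)"
    using assms(1) M(1) by (rule sum.remove)
  moreover have "Q (Suc k) + 2 * k + 3 = Q k + (k + 2)\<^sup>2"
    by (simp add: Q_Suc power2_eq_square)
  ultimately show ?thesis by linarith
qed

lemma sum_squares_valid_answers_le_cost: "(\<Sum>a | valid_answer T a. a\<^sup>2) \<le> cost T"
proof -
  obtain R where "T = self_counting {a. valid_answer T a} + R"
    using self_counting_valid_answers_subset by (metis subset_mset.le_iff_add)
  then have "cost T = cost (self_counting {a. valid_answer T a}) + cost R"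
    by (metis cost_add)
  then show ?thesis
    by (simp add: cost_self_counting[OF finite_valid_answers])
qed

lemma Q_num_valid_le_cost: "Q (num_valid T) \<le> cost T"
proof -
  have "Q (num_valid T) \<le> (\<Sum>a | valid_answer T a. a\<^sup>2)"
    unfolding num_valid_def
    by (rule Q_card_le_sum_squares) (auto simp: finite_valid_answers valid_answer_def)
  also have "\<dots> \<le> cost T"
    by (rule sum_squares_valid_answers_le_cost)
  finally show ?thesis .
qed

text \<open>
  The surplus over the copies of valid answers consists of answers that are not valid; when the
  valid answers fill an initial segment, each of these answers lies beyond it.
\<close>

lemma surplus_over_initial_segment:
  assumes "natural_test T" and valid: "{a. valid_answer T a} = {1..m}" and "Q m < cost T"
  shows "Q m + m < cost T"
proof -
  obtain R where R: "T = self_counting {1..m} + R"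
    using self_counting_valid_answers_subset[of T] valid by (metis subset_mset.le_iff_add)
  have cost_T: "cost T = Q m + cost R"
    unfolding R cost_add cost_self_counting[OF finite_atLeastAtMost]
      sum_squares_atLeastAtMost_eq_Q ..
  then have "R \<noteq> {#}"
    using assms(3) by (auto simp: cost_def)
  then obtain b where b: "b \<in># R" by (rule multiset_nonemptyE)
  then have "0 < b"
    using assms(1) R by (auto simp: natural_test_def)
  have "b \<notin> {1..m}"
  proof
    assume seg: "b \<in> {1..m}"
    then have "valid_answer T b"
      using valid by blast
    then have "b = count (self_counting {1..m}) b + count R b"
      using R by (metis count_union valid_answer_def)
    then have "count R b = 0"
      using seg by (simp add: count_self_counting)
    then show False
      using b by (simp add: count_eq_zero_iff)
  qed
  then have "m < b"
    using \<open>0 < b\<close> by auto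
  also have "b \<le> cost R"
    using b sum_mset.remove[of b R] by (simp add: cost_def)
  finally show ?thesis
    using cost_T by simp
qed

lemma num_valid_ge_by_large_surplus:
  assumes "\<forall>b\<in>#R. k < b"
  shows "natural_test (self_counting {1..k} + R)"
    and "cost (self_counting {1..k} + R) = Q k + cost R"
    and "k \<le> num_valid (self_counting {1..k} + R)"
proof -
  have "0 < a" if "a \<in># self_counting {1..k}" for a
    using that by (simp add: count_self_counting flip: count_greater_zero_iff split: if_splits)
  moreover have "0 < a" if "a \<in># R" for a
    using that assms by fastforce
  ultimately show "natural_test (self_counting {1..k} + R)"
    by (auto simp: natural_test_def)
  show "cost (self_counting {1..k} + R) = Q k + cost R"
    unfolding cost_add cost_self_counting[OF finite_atLeastAtMost]
      sum_squares_atLeastAtMost_eq_Q ..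
  have "count R a = 0" if "a \<le> k" for a
    using that assms by (auto simp: not_in_iff[symmetric])
  then have "{1..k} \<subseteq> {a. valid_answer (self_counting {1..k} + R) a}"
    by (auto simp: valid_answer_def count_self_counting)
  from card_mono[OF finite_valid_answers this]
  show "k \<le> num_valid (self_counting {1..k} + R)"
    by (simp add: num_valid_def)
qed

lemma attains_k_valid:
  assumes "C = Q k \<or> Q k + k < C"
  shows "\<exists>T. natural_test T \<and> cost T = C \<and> k \<le> num_valid T"
proof -
  define R where "R = (if C = Q k then {#} else {#C - Q k#})"
  have "\<forall>b\<in>#R. k < b" and "Q k + cost R = C"
    using assms by (auto simp: R_def cost_def)
  with num_valid_ge_by_large_surplus[of R k] show ?thesis by metis
qed

lemma num_valid_le_below_Q_Suc:
  assumes "cost T < Q (Suc k)"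
  shows "num_valid T \<le> k"
proof (rule ccontr)
  assume "\<not> num_valid T \<le> k"
  then have "Q (Suc k) \<le> Q (num_valid T)"
    by (intro Q_mono) simp
  with assms Q_num_valid_le_cost[of T] show False by simp
qed

lemma num_valid_le_just_above_Q_Suc:
  assumes "natural_test T" "Q (Suc k) < cost T" "cost T \<le> Q (Suc k) + Suc k"
  shows "num_valid T \<le> k"
proof -
  have "cost T < Q (Suc (Suc k))"
    using assms(3) by (simp add: Q_Suc power2_eq_square)
  then have "num_valid T \<le> Suc k"
    by (rule num_valid_le_below_Q_Suc)
  moreover have "num_valid T \<noteq> Suc k"
  proof
    assume "num_valid T = Suc k"
    then have card: "card {a. valid_answer T a} = Suc k"
      by (simp add: num_valid_def)
    show False
    proof (cases "{a. valid_answer T a} = {1..Suc k}")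
      case True
      from surplus_over_initial_segment[OF assms(1) this assms(2)] assms(3) show False by simp
    next
      case False
      have "\<forall>a\<in>{a. valid_answer T a}. 0 < a"
        by (simp add: valid_answer_def)
      from sum_squares_gap[OF finite_valid_answers this card False]
        sum_squares_valid_answers_le_cost[of T] assms(3)
      show False by simp
    qed
  qed
  ultimately show ?thesis by simp
qed

theorem theorem9:
  fixes C k :: nat
  assumes "C = Q k
    \<or> (Q k + k < C \<and> C < Q (k + 1))
    \<or> (Q (k + 1) < C \<and> C \<le> Q (k + 1) + k + 1)"
  shows "max_num_valid C = k"
proof -
  have upper: "num_valid T \<le> k" if "natural_test T" "cost T = C" for T
    using assms that num_valid_le_below_Q_Suc[of T k] num_valid_le_just_above_Q_Suc[of T k]
    by (auto simp: Q_Suc)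
  have "Q k + k < Q (k + 1)"
    by (simp add: Q_Suc power2_eq_square)
  then have "C = Q k \<or> Q k + k < C"
    using assms by linarith
  then obtain T where T: "natural_test T" "cost T = C" "k \<le> num_valid T"
    using attains_k_valid by blast
  with upper have "num_valid T = k"
    by (simp add: le_antisym)
  with T upper show ?thesis
    unfolding max_num_valid_def by (intro Max_eqI finite_num_valid) auto
qed

end
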